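(* For every $u\in L^{2,1}_{\mathcal{E}}$, $$B(u):=4\pi\mathcal{H}(u)+\frac14\left(M(u)P(u)-|Q(u)|^2\right)-\frac12 M(u)^2\ \ge\ 0.$$
   Context: $L$ denotes Lebesgue measure on $\mathbb{C}$. The space is $L^{2,1}_{\mathcal{E}}=\{u(z)=e^{-|z|^2/2}f(z): f\text{ entire holomorphic on }\mathbb{C},\ \int_{\mathbb{C}}(1+|z|^2)|u(z)|^2\,dL(z)<\infty\}$. The quantities are $\mathcal{H}(u)=\frac14\int_{\mathbb{C}}|u|^4\,dL$, $M(u)=\int_{\mathbb{C}}|u|^2\,dL$, $P(u)=\int_{\mathbb{C}}(|z|^2-1)|u(z)|^2\,dL(z)$, $Q(u)=\int_{\mathbb{C}}z|u(z)|^2\,dL(z)$. *)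

theory Defs
  imports "HOL-Analysis.Analysis"
begin

text \<open>
  Functions of the form \<open>u z = exp (- \<bar>z\<bar>\<^sup>2 / 2) * f z\<close> with \<open>f\<close> entire and
  \<open>u\<close> of finite weighted norm. Elements are actual functions rather than
  almost-everywhere classes: each class has exactly one continuous representative.
\<close>

definition L21E :: "(complex \<Rightarrow> complex) set" where
  "L21E = {u. (\<exists>f. f holomorphic_on UNIV \<and>
                   (\<forall>z. u z = complex_of_real (exp (- (cmod z)\<^sup>2 / 2)) * f z)) \<and>
              integrable lborel (\<lambda>z. (1 + (cmod z)\<^sup>2) * (cmod (u z))\<^sup>2)}"

text \<open>
  On \<^term>\<open>L21E\<close> all the integrands below are integrable (elements of the space are bounded,
  which covers the quartic one), so the default value \<open>0\<close> of the
  Bochner integral on non-integrable functions plays no role.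
\<close>

definition hamiltonian :: "(complex \<Rightarrow> complex) \<Rightarrow> real" where
  "hamiltonian u = 1 / 4 * (\<integral>z. (cmod (u z)) ^ 4 \<partial>lborel)"

definition mass :: "(complex \<Rightarrow> complex) \<Rightarrow> real" where
  "mass u = (\<integral>z. (cmod (u z))\<^sup>2 \<partial>lborel)"

definition angular_momentum :: "(complex \<Rightarrow> complex) \<Rightarrow> real" where
  "angular_momentum u = (\<integral>z. ((cmod z)\<^sup>2 - 1) * (cmod (u z))\<^sup>2 \<partial>lborel)"

definition magnetic_momentum :: "(complex \<Rightarrow> complex) \<Rightarrow> complex" where
  "magnetic_momentum u = (\<integral>z. z * complex_of_real ((cmod (u z))\<^sup>2) \<partial>lborel)"

definition B :: "(complex \<Rightarrow> complex) \<Rightarrow> real" where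
  "B u = 4 * pi * hamiltonian u
         + 1 / 4 * (mass u * angular_momentum u - (cmod (magnetic_momentum u))\<^sup>2)
         - 1 / 2 * (mass u)\<^sup>2"

end

theory Submission
  imports Defs "HOL-Complex_Analysis.Cauchy_Integral_Formula" "HOL-Probability.Distributions"
begin

text \<open>
  Writing \<open>M (P + M) - \<bar>Q\<bar>\<^sup>2\<close> as half the double integral of
  \<open>\<bar>z - w\<bar>\<^sup>2 \<bar>u z\<bar>\<^sup>2 \<bar>u w\<bar>\<^sup>2\<close>, one gets
  \<open>8 B(u) = 8 \<pi> \<integral> \<bar>u\<bar>\<^sup>4 + \<integral>\<integral> (\<bar>z - w\<bar>\<^sup>2 - 6) \<bar>u z\<bar>\<^sup>2 \<bar>u w\<bar>\<^sup>2\<close>.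
  In the coordinates \<open>z = c + s / 2\<close>, \<open>w = c - s / 2\<close> the Gaussian weight splits into
  \<open>exp (- 2 \<bar>c\<bar>\<^sup>2) exp (- \<bar>s\<bar>\<^sup>2 / 2)\<close>, so it suffices to show, for each fixed \<open>c\<close> and the even
  entire function \<open>g s = f (c + s / 2) f (c - s / 2)\<close>, that
  \<open>\<integral> (\<bar>s\<bar>\<^sup>2 - 6) \<bar>g s\<bar>\<^sup>2 exp (- \<bar>s\<bar>\<^sup>2 / 2) + 8 \<pi> \<bar>g 0\<bar>\<^sup>2 \<ge> 0\<close>.
  The monomials are orthogonal for this weight, and \<open>s ^ l\<close> contributes
  \<open>(2 l - 4) 2 \<pi> 2 ^ l l!\<close> times its squared coefficient to the integral: for \<open>l = 0\<close> this is
  cancelled by the last term, \<open>l = 1\<close> does not occur since \<open>g\<close> is even, and for \<open>l \<ge> 2\<close> it is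
  nonnegative.
\<close>

section \<open>Lebesgue measure on the plane: coordinates, translations, shears and
  rotations\<close>

lemma borel_measurable_Complex [measurable (raw)]:
  assumes "f \<in> borel_measurable M" "g \<in> borel_measurable M"
  shows "(\<lambda>x. Complex (f x) (g x)) \<in> borel_measurable M"
  using assms by (simp add: Complex_eq)

text \<open>Lebesgue measure is determined by its values on boxes, and a complex box pulls back to a
  product of two open intervals. This opens the way to Tonelli in the real and imaginary
  parts.\<close>

lemma lborel_complex_eq_distr:
  "(lborel :: complex measure) = distr (lborel \<Otimes>\<^sub>M lborel) borel (\<lambda>(x, y). Complex x y)"
proof (rule lborel_eqI)
  fix l u :: complex
  assume le: "\<And>b. b \<in> Basis \<Longrightarrow> l \<bullet> b \<le> u \<bullet> b"
  have "(\<lambda>(x, y). Complex x y) -` box l u \<inter> space (lborel \<Otimes>\<^sub>M lborel)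
        = {Re l<..<Re u} \<times> {Im l<..<Im u}"
    by (auto simp: box_def Basis_complex_def inner_complex_def space_pair_measure)
  then show "emeasure (distr (lborel \<Otimes>\<^sub>M lborel) borel (\<lambda>(x, y). Complex x y)) (box l u)
        = ennreal (\<Prod>b\<in>Basis. (u - l) \<bullet> b)"
    using le[of 1] le[of \<i>]
    by (simp add: emeasure_distr lborel.emeasure_pair_measure_Times Basis_complex_def
        inner_complex_def ennreal_mult)
qed simp

lemma nn_integral_complex_cartesian:
  assumes [measurable]: "h \<in> borel_measurable borel"
  shows "(\<integral>\<^sup>+z. h z \<partial>lborel) = (\<integral>\<^sup>+x. \<integral>\<^sup>+y. h (Complex x y) \<partial>lborel \<partial>lborel)"
proof -
  show ?thesis
    by (subst lborel_complex_eq_distr, subst nn_integral_distr)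
      (simp_all add: lborel.nn_integral_fst[symmetric])
qed

lemma nn_integral_lborel_translate:
  fixes h :: "'a :: euclidean_space \<Rightarrow> ennreal"
  assumes [measurable]: "h \<in> borel_measurable borel"
  shows "(\<integral>\<^sup>+x. h (c + x) \<partial>lborel) = (\<integral>\<^sup>+x. h x \<partial>lborel)"
  by (subst (2) lborel_distr_plus[symmetric, of c], subst nn_integral_distr) simp_all

text \<open>With one coordinate fixed, a shear only translates the other, so one-dimensional
  translation invariance suffices. If the sheared coordinate is the outer variable, Tonelli swaps
  the integrals before and after.\<close>

lemma nn_integral_lborel_shear:
  fixes h :: "real \<times> real \<Rightarrow> ennreal"
  assumes [measurable]: "h \<in> borel_measurable (borel \<Otimes>\<^sub>M borel)"
  shows "(\<integral>\<^sup>+x. \<integral>\<^sup>+y. h (x, t * x + y) \<partial>lborel \<partial>lborel) = (\<integral>\<^sup>+x. \<integral>\<^sup>+y. h (x, y) \<partial>lborel \<partial>lborel)"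
    and "(\<integral>\<^sup>+x. \<integral>\<^sup>+y. h (t * y + x, y) \<partial>lborel \<partial>lborel) = (\<integral>\<^sup>+x. \<integral>\<^sup>+y. h (x, y) \<partial>lborel \<partial>lborel)"
proof -
  show "(\<integral>\<^sup>+x. \<integral>\<^sup>+y. h (x, t * x + y) \<partial>lborel \<partial>lborel) = (\<integral>\<^sup>+x. \<integral>\<^sup>+y. h (x, y) \<partial>lborel \<partial>lborel)"
    by (subst nn_integral_lborel_translate) simp_all
  have "(\<integral>\<^sup>+x. \<integral>\<^sup>+y. h (t * y + x, y) \<partial>lborel \<partial>lborel)
        = (\<integral>\<^sup>+y. \<integral>\<^sup>+x. h (t * y + x, y) \<partial>lborel \<partial>lborel)"
    by (subst lborel_pair.Fubini') simp_all
  also have "\<dots> = (\<integral>\<^sup>+y. \<integral>\<^sup>+x. h (x, y) \<partial>lborel \<partial>lborel)"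
    by (subst nn_integral_lborel_translate[where h = "\<lambda>x. h (x, _)"]) simp_all
  also have "\<dots> = (\<integral>\<^sup>+x. \<integral>\<^sup>+y. h (x, y) \<partial>lborel \<partial>lborel)"
    by (subst lborel_pair.Fubini') simp_all
  finally show "(\<integral>\<^sup>+x. \<integral>\<^sup>+y. h (t * y + x, y) \<partial>lborel \<partial>lborel)
        = (\<integral>\<^sup>+x. \<integral>\<^sup>+y. h (x, y) \<partial>lborel \<partial>lborel)" .
qed

lemma nn_integral_complex_rotate:
  assumes h [measurable]: "h \<in> borel_measurable borel" and w: "cmod w = 1"
  shows "(\<integral>\<^sup>+z. h (w * z) \<partial>lborel) = (\<integral>\<^sup>+z. h z \<partial>lborel)"
proof -
  \<comment> \<open>A rotation by an angle other than \<open>\<pi>\<close> is a product of three shears.\<close>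
  have *: "(\<integral>\<^sup>+z. h (w * z) \<partial>lborel) = (\<integral>\<^sup>+z. h z \<partial>lborel)"
    if [measurable]: "h \<in> borel_measurable borel" and w: "cmod w = 1" and "w \<noteq> -1" for h w
  proof -
    define a b where "a = Re w" and "b = Im w"
    have ab: "a\<^sup>2 + b\<^sup>2 = 1" using w by (simp add: a_def b_def cmod_def)
    have "a \<noteq> -1"
    proof
      assume "a = -1"
      then have "w = -1" using ab by (simp add: a_def b_def complex_eq_iff)
      then show False using \<open>w \<noteq> -1\<close> by simp
    qed
    then have a1: "1 + a \<noteq> 0" by linarith
    \<comment> \<open>For \<open>w = cis \<theta>\<close> this is
      \<open>- tan (\<theta> / 2)\<close>: shearing \<open>x\<close> by \<open>t\<close>, then
      \<open>y\<close> by \<open>b\<close>, then \<open>x\<close> by \<open>t\<close> again is the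
      rotation by \<theta>.\<close>
    define t where "t = - b / (1 + a)"
    have t1: "b * t + 1 = a" using ab a1 by (simp add: t_def field_simps power2_eq_square)
    have t2: "t * (1 + a) = - b" using a1 by (simp add: t_def)
    have eq: "w * Complex x y = Complex (t * (b * (t * y + x) + y) + (t * y + x)) (b * (t * y + x) + y)" for x y
    proof -
      have "b * (t * y + x) + y = (b * t + 1) * y + b * x" by (simp add: algebra_simps)
      then have i: "b * (t * y + x) + y = a * y + b * x" by (simp add: t1)
      have "t * (a * y + b * x) + (t * y + x) = (t * (1 + a)) * y + (b * t + 1) * x"
        by (simp add: algebra_simps)
      then have "t * (a * y + b * x) + (t * y + x) = a * x - b * y" by (simp add: t1 t2)
      with i show ?thesis by (simp add: complex_eq_iff a_def b_def)
    qed
    define k where "k p = h (Complex (fst p) (snd p))" for p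
    have [measurable]: "k \<in> borel_measurable (borel \<Otimes>\<^sub>M borel)"
      unfolding k_def by measurable
    have "(\<integral>\<^sup>+z. h (w * z) \<partial>lborel)
      = (\<integral>\<^sup>+x. \<integral>\<^sup>+y. k (t * (b * (t * y + x) + y) + (t * y + x), b * (t * y + x) + y) \<partial>lborel \<partial>lborel)"
      by (subst nn_integral_complex_cartesian) (simp_all add: eq k_def)
    also have "\<dots> = (\<integral>\<^sup>+x. \<integral>\<^sup>+y. k (t * (b * x + y) + x, b * x + y) \<partial>lborel \<partial>lborel)"
      using nn_integral_lborel_shear(2)[of "\<lambda>(x, y). k (t * (b * x + y) + x, b * x + y)" t] by simp
    also have "\<dots> = (\<integral>\<^sup>+x. \<integral>\<^sup>+y. k (t * y + x, y) \<partial>lborel \<partial>lborel)"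
      using nn_integral_lborel_shear(1)[of "\<lambda>(x, y). k (t * y + x, y)" b] by simp
    also have "\<dots> = (\<integral>\<^sup>+x. \<integral>\<^sup>+y. k (x, y) \<partial>lborel \<partial>lborel)"
      by (rule nn_integral_lborel_shear(2)) simp
    also have "\<dots> = (\<integral>\<^sup>+z. h z \<partial>lborel)"
      by (subst nn_integral_complex_cartesian) (simp_all add: k_def)
    finally show ?thesis .
  qed
  show ?thesis
  proof (cases "w = -1")
    case True
    \<comment> \<open>The half turn, where \<open>1 + a\<close> would vanish, is split into two
      quarter turns.\<close>
    have "(\<integral>\<^sup>+z. h (w * z) \<partial>lborel) = (\<integral>\<^sup>+z. h (\<i> * (\<i> * z)) \<partial>lborel)"
      by (simp add: True mult.assoc[symmetric])
    also have "\<dots> = (\<integral>\<^sup>+z. h (\<i> * z) \<partial>lborel)"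
      by (rule *[of "\<lambda>z. h (\<i> * z)" \<i>]) (auto simp: complex_eq_iff)
    also have "\<dots> = (\<integral>\<^sup>+z. h z \<partial>lborel)"
      by (rule *) (auto simp: complex_eq_iff)
    finally show ?thesis .
  next
    case False
    then show ?thesis using * h w by blast
  qed
qed

section \<open>Radial integrals and Gaussian moments\<close>

text \<open>A disc of radius \<open>sqrt x\<close> has area \<open>pi * x\<close>, so both measures
  agree on the half-lines \<open>{..x}\<close>, which generate the Borel sets and are stable under
  intersection. This takes the place of polar coordinates for radial integrands.\<close>

lemma distr_lborel_cmod_power2:
  "distr (lborel :: complex measure) borel (\<lambda>z. (cmod z)\<^sup>2) = density lborel (\<lambda>t. ennreal pi * indicator {0..} t)"
  (is "?D = ?E")
proof (rule measure_eqI_generator_eq[where E = "range atMost" and A = "\<lambda>i. {..real i}" and \<Omega> = UNIV])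
  have eD: "emeasure ?D {..x} = (if x < 0 then 0 else ennreal (pi * x))" for x
  proof -
    have "(cmod z)\<^sup>2 \<le> x \<longleftrightarrow> 0 \<le> x \<and> cmod z \<le> sqrt x" for z
    proof (cases "0 \<le> x")
      case True
      then show ?thesis
        using real_sqrt_le_iff[of "(cmod z)\<^sup>2" x] by simp
    next
      case False
      then show ?thesis
        using zero_le_power2[of "cmod z"] by linarith
    qed
    then have "(\<lambda>z. (cmod z)\<^sup>2) -` {..x} \<inter> space lborel = (if x < 0 then {} else cball 0 (sqrt x))"
      by auto
    then show ?thesis
      by (auto simp: emeasure_distr emeasure_cball unit_ball_vol_2)
  qed
  have eE: "emeasure ?E {..x} = (if x < 0 then 0 else ennreal (pi * x))" for x
  proof -
    have "emeasure ?E {..x} = (\<integral>\<^sup>+t. ennreal pi * indicator {0..x} t \<partial>lborel)"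
      by (subst emeasure_density) (auto intro!: nn_integral_cong simp: indicator_def)
    then show ?thesis by (auto simp: nn_integral_cmult ennreal_mult')
  qed
  show "emeasure ?D X = emeasure ?E X" if "X \<in> range atMost" for X
    using that eD eE by auto
  show "emeasure ?D {..real i} \<noteq> \<infinity>" for i
    by (simp add: eD)
  show "Int_stable (range (atMost :: real \<Rightarrow> _))"
    by (auto simp: Int_stable_def)
  show "(\<Union>i. {..real i}) = UNIV"
    using real_arch_simple by auto
  show "sets ?D = sigma_sets UNIV (range atMost)" "sets ?E = sigma_sets UNIV (range atMost)"
    by (simp_all, simp_all only: borel_eq_atMost sets_measure_of_conv Pow_UNIV top_greatest if_True)
qed auto

text \<open>In the variable \<open>t = (cmod z)\<^sup>2\<close> this is \<open>pi\<close> times the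
  integral of \<open>t ^ l * exp (- t / 2)\<close> over the half-line. Rescaling by 2 gives the
  factor \<open>2 * 2 ^ l\<close> and leaves the Gamma integral \<open>fact l\<close>.\<close>

lemma nn_integral_complex_gaussian_moment:
  "(\<integral>\<^sup>+z. ennreal ((cmod z) ^ (2 * l) * exp (- (cmod z)\<^sup>2 / 2)) \<partial>(lborel :: complex measure))
    = ennreal (2 * pi * 2 ^ l * fact l)"
proof -
  have "(\<integral>\<^sup>+z. ennreal ((cmod z) ^ (2 * l) * exp (- (cmod z)\<^sup>2 / 2)) \<partial>(lborel :: complex measure))
    = (\<integral>\<^sup>+t. ennreal (t ^ l * exp (- t / 2)) \<partial>distr (lborel :: complex measure) borel (\<lambda>z. (cmod z)\<^sup>2))"
    by (subst nn_integral_distr) (simp_all add: power_mult)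
  also have "\<dots> = (\<integral>\<^sup>+t. ennreal pi * (ennreal (t ^ l * exp (- t / 2)) * indicator {0..} t) \<partial>lborel)"
    by (simp add: distr_lborel_cmod_power2 nn_integral_density mult_ac)
  also have "\<dots> = ennreal pi * (\<integral>\<^sup>+t. ennreal (t ^ l * exp (- t / 2)) * indicator {0..} t \<partial>lborel)"
    by (rule nn_integral_cmult) simp
  also have "(\<integral>\<^sup>+t. ennreal (t ^ l * exp (- t / 2)) * indicator {0..} t \<partial>lborel)
     = ennreal 2 * (\<integral>\<^sup>+t. ennreal ((2 * t) ^ l * exp (- t)) * indicator {0..} (2 * t) \<partial>lborel)"
    using nn_integral_real_affine[of "\<lambda>t. ennreal (t ^ l * exp (- t / 2)) * indicator {0..} t" 2 0] by simp
  also have "(\<integral>\<^sup>+t. ennreal ((2 * t) ^ l * exp (- t)) * indicator {0..} (2 * t) \<partial>lborel)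
     = (\<integral>\<^sup>+t. ennreal (2 ^ l) * (ennreal (t ^ l * exp (- t)) * indicator {0..} t) \<partial>lborel)"
    by (intro nn_integral_cong)
      (auto simp: indicator_def power_mult_distrib ennreal_mult'[symmetric] mult_ac)
  also have "\<dots> = ennreal (2 ^ l) * (\<integral>\<^sup>+t. ennreal (t ^ l * exp (- t)) * indicator {0..} t \<partial>lborel)"
    by (rule nn_integral_cmult) simp
  also have "(\<integral>\<^sup>+t. ennreal (t ^ l * exp (- t)) * indicator {0..} t \<partial>lborel) = ennreal (fact l)"
    by (simp add: nn_intergal_power_times_exp_Ici)
  also have "ennreal pi * (ennreal 2 * (ennreal (2 ^ l) * ennreal (fact l))) = ennreal (2 * pi * 2 ^ l * fact l)"
    by (simp add: ennreal_mult[symmetric] mult_ac del: ennreal_numeral)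
  finally show ?thesis .
qed

section \<open>Orthogonality of the monomials on circles and for radial weights\<close>

text \<open>For \<open>m \<noteq> 0\<close> the antiderivative is itself periodic, so its boundary
  values cancel. The frequency is an integer because it will be a difference of two
  exponents.\<close>

lemma has_bochner_integral_cis_period:
  "has_bochner_integral lborel (\<lambda>t. indicator {0..2 * pi} t *\<^sub>R cis (of_int m * t))
     (if m = 0 then of_real (2 * pi) else 0)"
proof (cases "m = 0")
  case True
  have "has_bochner_integral lborel (\<lambda>t. indicator {0..2 * pi} t *\<^sub>R (1::complex)) (measure lborel {0..2*pi} *\<^sub>R 1)"
    by (intro has_bochner_integral_scaleR_left has_bochner_integral_real_indicator) auto
  then show ?thesis using True by (simp add: scaleR_conv_of_real)
next
  case False
  define F where "F t = cis (of_int m * t) / (\<i> * of_int m)" for t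
  have "has_bochner_integral lborel (\<lambda>t. indicator {0..2 * pi} t *\<^sub>R cis (of_int m * t)) (F (2 * pi) - F 0)"
  proof (rule has_bochner_integral_FTC_Icc)
    show "(F has_vector_derivative cis (of_int m * x)) (at x within {0..2 * pi})" for x
    proof -
      have "((\<lambda>z. exp (\<i> * (of_int m * z)) / (\<i> * of_int m)) has_field_derivative
              exp (\<i> * (of_int m * of_real x))) (at (of_real x))"
        using False by (auto intro!: derivative_eq_intros simp: mult.commute[of _ \<i>])
      from has_vector_derivative_real_field[OF this] show ?thesis
        by (simp add: F_def[abs_def] cis_conv_exp)
    qed
  qed (auto intro!: continuous_intros)
  moreover have "F (2 * pi) = F 0"
    by (simp add: F_def cis_multiple_2pi mult.commute[of "of_int m"])
  ultimately show ?thesis using False by simp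
qed

text \<open>Parseval on the circle of radius \<open>cmod z\<close>: in the squared modulus of a
  partial sum only the diagonal terms survive integration over a period, and dominated convergence
  passes to the full series.\<close>

lemma nn_integral_circle_power_series:
  fixes a :: "nat \<Rightarrow> complex"
  assumes g: "\<And>z. (\<lambda>l. a l * z ^ l) sums g z"
  shows "(\<integral>\<^sup>+t. ennreal ((cmod (g (cis t * z)))\<^sup>2) * indicator {0..2 * pi} t \<partial>lborel)
    = ennreal (2 * pi) * (\<Sum>l. ennreal ((cmod (a l))\<^sup>2 * cmod z ^ (2 * l)))"
proof -
  define P where "P n t = (\<Sum>l<n. a l * (cis t * z) ^ l)" for n t
  define q where "q l = (cmod (a l))\<^sup>2 * cmod z ^ (2 * l)" for l
  have P_meas [measurable]: "P n \<in> borel_measurable borel" for n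
    unfolding P_def cis_conv_exp
    by (intro borel_measurable_continuous_onI continuous_intros)
  have expand: "complex_of_real ((cmod (P n t))\<^sup>2)
      = (\<Sum>j<n. \<Sum>k<n. (a j * z ^ j * cnj (a k * z ^ k)) * cis (of_int (int j - int k) * t))" for n t
  proof -
    have "cis (real_of_int (int j - int k) * t) = cis t ^ j * cnj (cis t ^ k)" for j k
      by (simp only: complex_cnj_power cis_cnj Complex.DeMoivre cis_mult) (simp add: algebra_simps)
    then show ?thesis
      unfolding complex_norm_square P_def
      by (simp add: sum_product power_mult_distrib mult_ac)
  qed
  have diag: "(\<Sum>j<n. \<Sum>k<n. (a j * z ^ j * cnj (a k * z ^ k)) *
      (if int j - int k = 0 then of_real (2 * pi) else 0)) = complex_of_real (2 * pi * sum q {..<n})" for n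
  proof -
    have "(\<Sum>k<n. (a j * z ^ j * cnj (a k * z ^ k)) * (if int j - int k = 0 then of_real (2 * pi) else 0))
        = complex_of_real (2 * pi * q j)" if "j < n" for j
    proof -
      have "(\<Sum>k<n. (a j * z ^ j * cnj (a k * z ^ k)) * (if int j - int k = 0 then of_real (2 * pi) else 0))
        = (\<Sum>k<n. if j = k then (a j * z ^ j * cnj (a j * z ^ j)) * of_real (2 * pi) else 0)"
        by (intro sum.cong) auto
      also have "\<dots> = (a j * z ^ j * cnj (a j * z ^ j)) * of_real (2 * pi)"
        using that by simp
      also have "\<dots> = of_real ((cmod (a j * z ^ j))\<^sup>2) * of_real (2 * pi)"
        by (simp only: complex_norm_square)
      also have "\<dots> = complex_of_real (2 * pi * q j)"
        by (simp add: q_def norm_mult norm_power power_mult_distrib power_mult[symmetric] mult_ac)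
      finally show ?thesis .
    qed
    then show ?thesis
      by (simp add: sum_distrib_left)
  qed
  have "has_bochner_integral lborel (\<lambda>t. \<Sum>j<n. \<Sum>k<n. (a j * z ^ j * cnj (a k * z ^ k)) *
      (indicator {0..2 * pi} t *\<^sub>R cis (of_int (int j - int k) * t))) (complex_of_real (2 * pi * sum q {..<n}))" for n
    unfolding diag[symmetric]
    by (intro has_bochner_integral_sum has_bochner_integral_mult_right has_bochner_integral_cis_period)
  then have "has_bochner_integral lborel (\<lambda>t. complex_of_real (indicator {0..2 * pi} t * (cmod (P n t))\<^sup>2))
      (complex_of_real (2 * pi * sum q {..<n}))" for n
    by (simp only: of_real_mult expand scaleR_conv_of_real sum_distrib_left
        mult.left_commute[of "complex_of_real (indicator _ _)"])
  from has_bochner_integral_bounded_linear[OF bounded_linear_Re this]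
  have "has_bochner_integral lborel (\<lambda>t. indicator {0..2 * pi} t * (cmod (P n t))\<^sup>2) (2 * pi * sum q {..<n})" for n
    by simp
  then have bochner: "integrable lborel (\<lambda>t. indicator {0..2 * pi} t * (cmod (P n t))\<^sup>2)"
      "(\<integral>t. indicator {0..2 * pi} t * (cmod (P n t))\<^sup>2 \<partial>lborel) = 2 * pi * sum q {..<n}" for n
    by (simp_all add: has_bochner_integral_iff)
  have fin: "(\<integral>\<^sup>+t. ennreal ((cmod (P n t))\<^sup>2) * indicator {0..2 * pi} t \<partial>lborel)
      = ennreal (2 * pi) * (\<Sum>l<n. ennreal (q l))" for n
  proof -
    have "(\<integral>\<^sup>+t. ennreal ((cmod (P n t))\<^sup>2) * indicator {0..2 * pi} t \<partial>lborel)
        = (\<integral>\<^sup>+t. ennreal (indicator {0..2 * pi} t * (cmod (P n t))\<^sup>2) \<partial>lborel)"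
      by (intro nn_integral_cong) (simp split: split_indicator)
    also have "\<dots> = ennreal (2 * pi * sum q {..<n})"
      by (subst nn_integral_eq_integral[OF bochner(1)]) (simp_all add: bochner(2))
    also have "\<dots> = ennreal (2 * pi) * (\<Sum>l<n. ennreal (q l))"
      by (subst sum_ennreal) (simp_all add: ennreal_mult' q_def)
    finally show ?thesis .
  qed
  \<comment> \<open>A bound for all partial sums on the whole circle, serving as the dominating
    constant. It is finite because the series converges at the larger radius
    \<open>cmod z + 1\<close>, hence absolutely at radius \<open>cmod z\<close>.\<close>
  define S where "S = (\<Sum>l. norm (a l * (of_real (cmod z)) ^ l))"
  have summ: "summable (\<lambda>l. norm (a l * (of_real (cmod z)) ^ l))"
    by (rule powser_insidea[where x = "of_real (cmod z + 1)"]) (use g in \<open>auto simp: sums_iff simp del: of_real_add\<close>)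
  have P_le: "cmod (P n t) \<le> S" for n t
  proof -
    have "cmod (P n t) \<le> (\<Sum>l<n. norm (a l * (of_real (cmod z)) ^ l))"
      unfolding P_def by (rule sum_norm_le) (simp add: norm_mult norm_power)
    also have "\<dots> \<le> S"
      unfolding S_def by (rule sum_le_suminf[OF summ]) auto
    finally show ?thesis .
  qed
  have P_lim: "(\<lambda>n. P n t) \<longlonglongrightarrow> g (cis t * z)" for t
    using g[of "cis t * z"] unfolding sums_def P_def .
  have "(\<lambda>n. \<integral>\<^sup>+t. ennreal ((cmod (P n t))\<^sup>2) * indicator {0..2 * pi} t \<partial>lborel)
      \<longlonglongrightarrow> (\<integral>\<^sup>+t. ennreal ((cmod (g (cis t * z)))\<^sup>2) * indicator {0..2 * pi} t \<partial>lborel)"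
  proof (rule nn_integral_dominated_convergence[where w = "\<lambda>t. ennreal (S\<^sup>2) * indicator {0..2 * pi} t"])
    show "(\<lambda>t. ennreal ((cmod (g (cis t * z)))\<^sup>2) * indicator {0..2 * pi} t) \<in> borel_measurable lborel"
      using borel_measurable_LIMSEQ_metric[of P lborel, OF _ P_lim] by measurable
    show "AE t in lborel. (\<lambda>n. ennreal ((cmod (P n t))\<^sup>2) * indicator {0..2 * pi} t)
        \<longlonglongrightarrow> ennreal ((cmod (g (cis t * z)))\<^sup>2) * indicator {0..2 * pi} t"
      by (intro AE_I2 tendsto_intros ennreal_tendsto_cmult P_lim) (auto simp: indicator_def intro!: tendsto_intros P_lim)
    show "AE t in lborel. ennreal ((cmod (P n t))\<^sup>2) * indicator {0..2 * pi} t \<le> ennreal (S\<^sup>2) * indicator {0..2 * pi} t" for n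
      using P_le by (intro AE_I2 mult_right_mono ennreal_leI power_mono) auto
    show "(\<integral>\<^sup>+t. ennreal (S\<^sup>2) * indicator {0..2 * pi} t \<partial>lborel) < \<infinity>"
      by (simp add: nn_integral_cmult ennreal_mult_less_top)
  qed auto
  moreover have "(\<lambda>n. ennreal (2 * pi) * (\<Sum>l<n. ennreal (q l))) \<longlonglongrightarrow> ennreal (2 * pi) * (\<Sum>l. ennreal (q l))"
    by (intro ennreal_tendsto_cmult summable_LIMSEQ) auto
  ultimately show ?thesis
    unfolding fin q_def by (rule LIMSEQ_unique)
qed

text \<open>A radial weight is rotation invariant, so the integral may be averaged over all
  rotations; after Tonelli, Parseval on each circle removes the cross terms. Working in
  \<open>ennreal\<close> makes the identity valid even when both sides are infinite.\<close>

lemma nn_integral_radial_power_series: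
  fixes a :: "nat \<Rightarrow> complex"
  assumes g: "\<And>z. (\<lambda>l. a l * z ^ l) sums g z" and [measurable]: "\<phi> \<in> borel_measurable borel"
  shows "(\<integral>\<^sup>+z. \<phi> (cmod z) * ennreal ((cmod (g z))\<^sup>2) \<partial>lborel)
    = (\<Sum>l. ennreal ((cmod (a l))\<^sup>2) * (\<integral>\<^sup>+z. \<phi> (cmod z) * ennreal (cmod z ^ (2 * l)) \<partial>(lborel :: complex measure)))"
proof -
  have [measurable]: "g \<in> borel_measurable borel"
    by (rule borel_measurable_LIMSEQ_metric[of "\<lambda>n z. \<Sum>l<n. a l * z ^ l"])
      (use g in \<open>auto simp: sums_def\<close>)
  have [measurable]: "cis \<in> borel_measurable borel"
    by (intro borel_measurable_continuous_onI continuous_intros)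
  let ?I = "\<integral>\<^sup>+z. \<phi> (cmod z) * ennreal ((cmod (g z))\<^sup>2) \<partial>lborel"
  \<comment> \<open>The average is taken without normalisation; the factor \<open>2 * pi\<close>
    reappears from Parseval and is cancelled at the end.\<close>
  have "ennreal (2 * pi) * ?I = (\<integral>\<^sup>+t. ?I * indicator {0..2 * pi} t \<partial>lborel)"
    by (subst nn_integral_cmult_indicator) (simp_all add: mult.commute)
  also have "\<dots> = (\<integral>\<^sup>+t. \<integral>\<^sup>+z. \<phi> (cmod z) * ennreal ((cmod (g (cis t * z)))\<^sup>2) * indicator {0..2 * pi} t \<partial>lborel \<partial>lborel)"
  proof (rule nn_integral_cong)
    fix t
    have "?I = (\<integral>\<^sup>+z. \<phi> (cmod (cis t * z)) * ennreal ((cmod (g (cis t * z)))\<^sup>2) \<partial>lborel)"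
      by (rule nn_integral_complex_rotate[symmetric]) auto
    then show "?I * indicator {0..2 * pi} t
        = (\<integral>\<^sup>+z. \<phi> (cmod z) * ennreal ((cmod (g (cis t * z)))\<^sup>2) * indicator {0..2 * pi} t \<partial>lborel)"
      by (simp add: norm_mult nn_integral_multc)
  qed
  also have "\<dots> = (\<integral>\<^sup>+z. \<integral>\<^sup>+t. \<phi> (cmod z) * (ennreal ((cmod (g (cis t * z)))\<^sup>2) * indicator {0..2 * pi} t) \<partial>lborel \<partial>lborel)"
    by (subst lborel_pair.Fubini') (simp_all add: mult.assoc)
  also have "\<dots> = (\<integral>\<^sup>+z. \<phi> (cmod z) * (ennreal (2 * pi) * (\<Sum>l. ennreal ((cmod (a l))\<^sup>2 * cmod z ^ (2 * l)))) \<partial>lborel)"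
    by (subst nn_integral_cmult) (simp_all only: nn_integral_circle_power_series[OF g], measurable)
  also have "\<dots> = (\<integral>\<^sup>+z. ennreal (2 * pi) * (\<Sum>l. ennreal ((cmod (a l))\<^sup>2) * (\<phi> (cmod z) * ennreal (cmod z ^ (2 * l)))) \<partial>lborel)"
    by (intro nn_integral_cong, subst mult.left_commute, subst ennreal_suminf_cmult[symmetric])
      (simp add: ennreal_mult mult.left_commute)
  also have "\<dots> = ennreal (2 * pi) * (\<Sum>l. ennreal ((cmod (a l))\<^sup>2) * (\<integral>\<^sup>+z. \<phi> (cmod z) * ennreal (cmod z ^ (2 * l)) \<partial>(lborel :: complex measure)))"
    by (simp add: nn_integral_cmult nn_integral_suminf)
  finally show ?thesis
    by (subst (asm) ennreal_mult_cancel_left) auto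
qed

section \<open>Gaussian integrals of entire functions and the coefficientwise inequality\<close>

text \<open>The previous result is applied to the Taylor series at 0. The extra factor
  \<open>cmod z ^ (2 * k)\<close> shifts the Gaussian moment from \<open>l\<close> to
  \<open>l + k\<close>; the cases \<open>k = 0\<close> and \<open>k = 1\<close> are the ones to be
  compared.\<close>

lemma nn_integral_gaussian_entire:
  assumes g: "g holomorphic_on UNIV"
  shows "(\<integral>\<^sup>+z. ennreal (cmod z ^ (2 * k) * exp (- (cmod z)\<^sup>2 / 2)) * ennreal ((cmod (g z))\<^sup>2) \<partial>lborel)
    = (\<Sum>l. ennreal ((cmod ((deriv ^^ l) g 0 / fact l))\<^sup>2 * (2 * pi * 2 ^ (l + k) * fact (l + k))))"
proof -
  have g_sums: "(\<lambda>l. (deriv ^^ l) g 0 / fact l * z ^ l) sums g z" for z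
    using holomorphic_power_series[of g 0 "cmod z + 1" z] g by (auto intro: holomorphic_on_subset)
  have m: "(\<lambda>r. ennreal (r ^ (2 * k) * exp (- r\<^sup>2 / 2))) \<in> borel_measurable borel"
    by measurable
  have moment: "(\<integral>\<^sup>+z. ennreal (cmod z ^ (2 * k) * exp (- (cmod z)\<^sup>2 / 2)) * ennreal (cmod z ^ (2 * l)) \<partial>(lborel :: complex measure))
      = ennreal (2 * pi * 2 ^ (l + k) * fact (l + k))" for l
    unfolding nn_integral_complex_gaussian_moment[symmetric]
    by (intro nn_integral_cong) (simp add: ennreal_mult[symmetric] power_add distrib_left mult_ac)
  show ?thesis
    unfolding nn_integral_radial_power_series[OF g_sums m] moment
    by (simp add: ennreal_mult)
qed

text \<open>Both bounds compare Taylor coefficients term by term. The first keeps only the term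
  \<open>l = 0\<close>. The second rests on consecutive moments having ratio
  \<open>2 * (l + 1)\<close>; it is stated without subtraction so that it makes sense in
  \<open>ennreal\<close> for integrals that may be infinite.\<close>

lemma gaussian_entire_ineq:
  assumes g: "g holomorphic_on UNIV"
  shows "ennreal (2 * pi * (cmod (g 0))\<^sup>2)
      \<le> (\<integral>\<^sup>+z. ennreal (exp (- (cmod z)\<^sup>2 / 2)) * ennreal ((cmod (g z))\<^sup>2) \<partial>lborel)"
    and "deriv g 0 = 0 \<Longrightarrow>
      6 * (\<integral>\<^sup>+z. ennreal (exp (- (cmod z)\<^sup>2 / 2)) * ennreal ((cmod (g z))\<^sup>2) \<partial>lborel)
      \<le> (\<integral>\<^sup>+z. ennreal ((cmod z)\<^sup>2 * exp (- (cmod z)\<^sup>2 / 2)) * ennreal ((cmod (g z))\<^sup>2) \<partial>lborel)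
        + ennreal (8 * pi * (cmod (g 0))\<^sup>2)"
proof -
  define a where "a l = (cmod ((deriv ^^ l) g 0 / fact l))\<^sup>2" for l
  have a0: "a 0 = (cmod (g 0))\<^sup>2" and a_nonneg: "a l \<ge> 0" for l
    by (simp_all add: a_def)
  have int0: "(\<integral>\<^sup>+z. ennreal (exp (- (cmod z)\<^sup>2 / 2)) * ennreal ((cmod (g z))\<^sup>2) \<partial>lborel)
      = (\<Sum>l. ennreal (a l * (2 * pi * 2 ^ l * fact l)))"
    using nn_integral_gaussian_entire[OF g, of 0] by (simp add: a_def)
  have int1: "(\<integral>\<^sup>+z. ennreal ((cmod z)\<^sup>2 * exp (- (cmod z)\<^sup>2 / 2)) * ennreal ((cmod (g z))\<^sup>2) \<partial>lborel)
      = (\<Sum>l. ennreal (a l * (2 * pi * 2 ^ (l + 1) * fact (l + 1))))"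
    using nn_integral_gaussian_entire[OF g, of 1] by (simp only: a_def mult_1_right)
  show "ennreal (2 * pi * (cmod (g 0))\<^sup>2)
      \<le> (\<integral>\<^sup>+z. ennreal (exp (- (cmod z)\<^sup>2 / 2)) * ennreal ((cmod (g z))\<^sup>2) \<partial>lborel)"
    unfolding int0
    using sum_le_suminf[of "\<lambda>l. ennreal (a l * (2 * pi * 2 ^ l * fact l))" "{0}"]
    by (simp add: a0 mult_ac)
  assume "deriv g 0 = 0"
  then have a1: "a 1 = 0" by (simp add: a_def)
  have "6 * (\<Sum>l. ennreal (a l * (2 * pi * 2 ^ l * fact l)))
      = (\<Sum>l. 6 * ennreal (a l * (2 * pi * 2 ^ l * fact l)))"
    by (rule ennreal_suminf_cmult[symmetric])
  \<comment> \<open>At \<open>l = 0\<close> the two moments give \<open>12 * pi\<close> against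
    \<open>4 * pi\<close>, so the correction \<open>8 * pi * a 0\<close> yields equality
    there.\<close>
  also have "\<dots> \<le> (\<Sum>l. ennreal (a l * (2 * pi * 2 ^ (l + 1) * fact (l + 1)))
      + (if l = 0 then ennreal (8 * pi * a 0) else 0))"
  proof (rule suminf_le)
    fix l :: nat
    have "6 * (a l * (2 * pi * 2 ^ l * fact l))
        \<le> a l * (2 * pi * 2 ^ (l + 1) * fact (l + 1)) + (if l = 0 then 8 * pi * a 0 else 0)"
    proof -
      consider "l = 0" | "l = 1" | "l \<ge> 2" by linarith
      then show ?thesis
      proof cases
        case 3
        \<comment> \<open>From \<open>l = 2\<close> on, the ratio \<open>2 * (l + 1)\<close> is at
          least 6.\<close>
        then have "6 * (a l * (2 * pi * 2 ^ l * fact l)) \<le> (2 * (real l + 1)) * (a l * (2 * pi * 2 ^ l * fact l))"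
          by (intro mult_right_mono mult_nonneg_nonneg a_nonneg) auto
        with 3 show ?thesis by (simp add: algebra_simps)
      qed (use a1 in simp_all)
    qed
    then have "ennreal (6 * (a l * (2 * pi * 2 ^ l * fact l)))
        \<le> ennreal (a l * (2 * pi * 2 ^ (l + 1) * fact (l + 1)) + (if l = 0 then 8 * pi * a 0 else 0))"
      by (rule ennreal_leI)
    also have "\<dots> = ennreal (a l * (2 * pi * 2 ^ (l + 1) * fact (l + 1))) + (if l = 0 then ennreal (8 * pi * a 0) else 0)"
      by (subst ennreal_plus) (auto simp: a_nonneg)
    finally show "6 * ennreal (a l * (2 * pi * 2 ^ l * fact l))
        \<le> ennreal (a l * (2 * pi * 2 ^ (l + 1) * fact (l + 1))) + (if l = 0 then ennreal (8 * pi * a 0) else 0)"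
      by (simp only: ennreal_mult'[of 6, simplified] ennreal_numeral)
  qed auto
  also have "\<dots> = (\<Sum>l. ennreal (a l * (2 * pi * 2 ^ (l + 1) * fact (l + 1))))
      + (\<Sum>l. if l = 0 then ennreal (8 * pi * a 0) else 0)"
    by (rule suminf_add[symmetric]) auto
  also have "(\<Sum>l. if l = 0 then ennreal (8 * pi * a 0) else 0) = ennreal (8 * pi * (cmod (g 0))\<^sup>2)"
    using suminf_finite[of "{0::nat}" "\<lambda>l. if l = 0 then ennreal (8 * pi * a 0) else 0"] by (simp add: a0)
  finally show "6 * (\<integral>\<^sup>+z. ennreal (exp (- (cmod z)\<^sup>2 / 2)) * ennreal ((cmod (g z))\<^sup>2) \<partial>lborel)
      \<le> (\<integral>\<^sup>+z. ennreal ((cmod z)\<^sup>2 * exp (- (cmod z)\<^sup>2 / 2)) * ennreal ((cmod (g z))\<^sup>2) \<partial>lborel)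
        + ennreal (8 * pi * (cmod (g 0))\<^sup>2)"
    unfolding int0 int1 .
qed

section \<open>Midpoint coordinates and the two-point inequality\<close>

text \<open>The change of variables has Jacobian 1, being a composition of two translations:
  \<open>z = w + s\<close> for fixed \<open>w\<close>, then \<open>w = c - s / 2\<close> for fixed
  \<open>s\<close>.\<close>

lemma nn_integral_midpoint_coordinates:
  fixes F :: "complex \<times> complex \<Rightarrow> ennreal"
  assumes [measurable]: "F \<in> borel_measurable (borel \<Otimes>\<^sub>M borel)"
  shows "(\<integral>\<^sup>+w. \<integral>\<^sup>+z. F (z, w) \<partial>lborel \<partial>lborel)
    = (\<integral>\<^sup>+c. \<integral>\<^sup>+s. F (c + s / 2, c - s / 2) \<partial>lborel \<partial>lborel)"
proof -
  have "(\<integral>\<^sup>+w. \<integral>\<^sup>+z. F (z, w) \<partial>lborel \<partial>lborel) = (\<integral>\<^sup>+w. \<integral>\<^sup>+s. F (w + s, w) \<partial>lborel \<partial>lborel)"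
    by (subst nn_integral_lborel_translate[where h = "\<lambda>z. F (z, _)"]) simp_all
  also have "\<dots> = (\<integral>\<^sup>+s. \<integral>\<^sup>+w. F (w + s, w) \<partial>lborel \<partial>lborel)"
    by (subst lborel_pair.Fubini') simp_all
  also have "\<dots> = (\<integral>\<^sup>+s. \<integral>\<^sup>+c. F (c + s / 2, c - s / 2) \<partial>lborel \<partial>lborel)"
  proof (rule nn_integral_cong)
    fix s :: complex
    have "(\<integral>\<^sup>+c. F ((- s / 2 + c) + s, - s / 2 + c) \<partial>lborel) = (\<integral>\<^sup>+w. F (w + s, w) \<partial>lborel)"
      by (rule nn_integral_lborel_translate[where h = "\<lambda>w. F (w + s, w)"]) simp
    then show "(\<integral>\<^sup>+w. F (w + s, w) \<partial>lborel) = (\<integral>\<^sup>+c. F (c + s / 2, c - s / 2) \<partial>lborel)"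
      by (simp add: algebra_simps)
  qed
  also have "\<dots> = (\<integral>\<^sup>+c. \<integral>\<^sup>+s. F (c + s / 2, c - s / 2) \<partial>lborel \<partial>lborel)"
    by (subst lborel_pair.Fubini') simp_all
  finally show ?thesis .
qed

text \<open>The inequalities for one entire function are applied to \<open>g c\<close> for each
  midpoint \<open>c\<close> and integrated against \<open>exp (- 2 * (cmod c)\<^sup>2)\<close>. The
  first bound serves to show that the quartic integral is finite; the second carries the
  theorem.\<close>

lemma two_point_ineq:
  fixes f u :: "complex \<Rightarrow> complex"
  assumes f: "f holomorphic_on UNIV"
    and u: "\<And>z. u z = complex_of_real (exp (- (cmod z)\<^sup>2 / 2)) * f z"
  shows "ennreal (2 * pi) * (\<integral>\<^sup>+z. ennreal (cmod (u z) ^ 4) \<partial>lborel)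
      \<le> (\<integral>\<^sup>+w. \<integral>\<^sup>+z. ennreal ((cmod (u z))\<^sup>2 * (cmod (u w))\<^sup>2) \<partial>lborel \<partial>lborel)"
    and "6 * (\<integral>\<^sup>+w. \<integral>\<^sup>+z. ennreal ((cmod (u z))\<^sup>2 * (cmod (u w))\<^sup>2) \<partial>lborel \<partial>lborel)
      \<le> (\<integral>\<^sup>+w. \<integral>\<^sup>+z. ennreal ((cmod (z - w))\<^sup>2 * ((cmod (u z))\<^sup>2 * (cmod (u w))\<^sup>2)) \<partial>lborel \<partial>lborel)
        + ennreal (8 * pi) * (\<integral>\<^sup>+z. ennreal (cmod (u z) ^ 4) \<partial>lborel)"
proof -
  define g where "g c s = f (c + s / 2) * f (c - s / 2)" for c s
  define E where "E c = ennreal (exp (- 2 * (cmod c)\<^sup>2))" for c :: complex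
  define I where "I c = (\<integral>\<^sup>+s. ennreal (exp (- (cmod s)\<^sup>2 / 2)) * ennreal ((cmod (g c s))\<^sup>2) \<partial>lborel)" for c
  define J where "J c = (\<integral>\<^sup>+s. ennreal ((cmod s)\<^sup>2 * exp (- (cmod s)\<^sup>2 / 2)) * ennreal ((cmod (g c s))\<^sup>2) \<partial>lborel)" for c
  have [measurable]: "f \<in> borel_measurable borel"
    using f by (intro borel_measurable_continuous_onI holomorphic_on_imp_continuous_on)
  have [measurable]: "u \<in> borel_measurable borel"
    unfolding u[abs_def] by measurable
  have [measurable]: "I \<in> borel_measurable borel" "J \<in> borel_measurable borel"
    unfolding I_def[abs_def] J_def[abs_def] g_def by measurable
  have [measurable]: "E \<in> borel_measurable borel"
    unfolding E_def[abs_def] by measurable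
  have norm_u: "(cmod (u z))\<^sup>2 = exp (- (cmod z)\<^sup>2) * (cmod (f z))\<^sup>2" for z
    by (simp add: u norm_mult power_mult_distrib exp_double[symmetric])
  have parallelogram: "(cmod (c + s / 2))\<^sup>2 + (cmod (c - s / 2))\<^sup>2 = 2 * (cmod c)\<^sup>2 + (cmod s)\<^sup>2 / 2" for c s
    unfolding cmod_power2 by (simp add: power2_eq_square field_simps)
  have u_prod: "(cmod (u (c + s / 2)))\<^sup>2 * (cmod (u (c - s / 2)))\<^sup>2
      = exp (- 2 * (cmod c)\<^sup>2) * (exp (- (cmod s)\<^sup>2 / 2) * (cmod (g c s))\<^sup>2)" for c s
  proof -
    have "exp (- (cmod (c + s / 2))\<^sup>2) * exp (- (cmod (c - s / 2))\<^sup>2)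
        = exp (- ((cmod (c + s / 2))\<^sup>2 + (cmod (c - s / 2))\<^sup>2))"
      by (simp add: exp_add[symmetric])
    also have "\<dots> = exp (- 2 * (cmod c)\<^sup>2) * exp (- (cmod s)\<^sup>2 / 2)"
      by (simp add: parallelogram exp_add[symmetric])
    finally show ?thesis
      by (simp add: norm_u g_def norm_mult power_mult_distrib mult_ac)
  qed
  \<comment> \<open>The quartic integral lives on the diagonal \<open>s = 0\<close>, where both
    points coincide with \<open>c\<close>.\<close>
  have u4: "(\<integral>\<^sup>+z. ennreal (cmod (u z) ^ 4) \<partial>lborel) = (\<integral>\<^sup>+c. E c * ennreal ((cmod (g c 0))\<^sup>2) \<partial>lborel)"
  proof (rule nn_integral_cong)
    fix c
    have "cmod (u c) ^ 4 = (cmod (u (c + 0 / 2)))\<^sup>2 * (cmod (u (c - 0 / 2)))\<^sup>2"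
      by (simp add: power_add[symmetric])
    then show "ennreal (cmod (u c) ^ 4) = E c * ennreal ((cmod (g c 0))\<^sup>2)"
      unfolding u_prod by (simp add: E_def ennreal_mult)
  qed
  have mass: "(\<integral>\<^sup>+w. \<integral>\<^sup>+z. ennreal ((cmod (u z))\<^sup>2 * (cmod (u w))\<^sup>2) \<partial>lborel \<partial>lborel) = (\<integral>\<^sup>+c. E c * I c \<partial>lborel)"
  proof -
    have "(\<integral>\<^sup>+w. \<integral>\<^sup>+z. ennreal ((cmod (u z))\<^sup>2 * (cmod (u w))\<^sup>2) \<partial>lborel \<partial>lborel)
      = (\<integral>\<^sup>+c. \<integral>\<^sup>+s. ennreal ((cmod (u (c + s / 2)))\<^sup>2 * (cmod (u (c - s / 2)))\<^sup>2) \<partial>lborel \<partial>lborel)"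
      using nn_integral_midpoint_coordinates[of "\<lambda>(z, w). ennreal ((cmod (u z))\<^sup>2 * (cmod (u w))\<^sup>2)"]
      by simp
    also have "\<dots> = (\<integral>\<^sup>+c. \<integral>\<^sup>+s. E c * (ennreal (exp (- (cmod s)\<^sup>2 / 2)) * ennreal ((cmod (g c s))\<^sup>2)) \<partial>lborel \<partial>lborel)"
      unfolding u_prod E_def by (simp add: ennreal_mult)
    also have "\<dots> = (\<integral>\<^sup>+c. E c * I c \<partial>lborel)"
      unfolding I_def g_def by (intro nn_integral_cong nn_integral_cmult) measurable
    finally show ?thesis .
  qed
  have moment: "(\<integral>\<^sup>+w. \<integral>\<^sup>+z. ennreal ((cmod (z - w))\<^sup>2 * ((cmod (u z))\<^sup>2 * (cmod (u w))\<^sup>2)) \<partial>lborel \<partial>lborel)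
      = (\<integral>\<^sup>+c. E c * J c \<partial>lborel)"
  proof -
    have "(\<integral>\<^sup>+w. \<integral>\<^sup>+z. ennreal ((cmod (z - w))\<^sup>2 * ((cmod (u z))\<^sup>2 * (cmod (u w))\<^sup>2)) \<partial>lborel \<partial>lborel)
      = (\<integral>\<^sup>+c. \<integral>\<^sup>+s. ennreal ((cmod s)\<^sup>2 * ((cmod (u (c + s / 2)))\<^sup>2 * (cmod (u (c - s / 2)))\<^sup>2)) \<partial>lborel \<partial>lborel)"
      using nn_integral_midpoint_coordinates[of "\<lambda>(z, w). ennreal ((cmod (z - w))\<^sup>2 * ((cmod (u z))\<^sup>2 * (cmod (u w))\<^sup>2))"]
      by simp
    also have "\<dots> = (\<integral>\<^sup>+c. \<integral>\<^sup>+s. E c * (ennreal ((cmod s)\<^sup>2 * exp (- (cmod s)\<^sup>2 / 2)) * ennreal ((cmod (g c s))\<^sup>2)) \<partial>lborel \<partial>lborel)"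
      unfolding u_prod E_def
      by (intro nn_integral_cong) (simp add: ennreal_mult[symmetric] mult_ac)
    also have "\<dots> = (\<integral>\<^sup>+c. E c * J c \<partial>lborel)"
      unfolding J_def g_def by (intro nn_integral_cong nn_integral_cmult) measurable
    finally show ?thesis .
  qed
  have g_holo: "g c holomorphic_on UNIV" for c
    unfolding g_def[abs_def]
    by (intro holomorphic_intros holomorphic_on_compose_gen[OF _ f, unfolded o_def]) auto
  \<comment> \<open>Evenness of \<open>g c\<close> enters here: the derivatives of the two factors
    at 0 are opposite.\<close>
  have g_deriv: "deriv (g c) 0 = 0" for c
  proof -
    have "(f has_field_derivative deriv f c) (at c)"
      using f by (intro holomorphic_derivI[of f UNIV]) auto
    then have d: "(f has_field_derivative deriv f c) (at (c + 0 / 2))"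
      "(f has_field_derivative deriv f c) (at (c - 0 / 2))" by simp_all
    have "((\<lambda>s. f (c + s / 2)) has_field_derivative deriv f c * (1 / 2)) (at 0)"
      by (rule DERIV_chain2[where f = f and g = "\<lambda>s. c + s / 2", OF d(1)])
        (auto intro!: derivative_eq_intros)
    moreover have "((\<lambda>s. f (c - s / 2)) has_field_derivative deriv f c * (- 1 / 2)) (at 0)"
      by (rule DERIV_chain2[where f = f and g = "\<lambda>s. c - s / 2", OF d(2)])
        (auto intro!: derivative_eq_intros)
    ultimately have "(g c has_field_derivative 0) (at 0)"
      unfolding g_def[abs_def] by (rule DERIV_cong[OF DERIV_mult]) simp
    then show ?thesis by (rule DERIV_imp_deriv)
  qed
  have "ennreal (2 * pi) * (\<integral>\<^sup>+z. ennreal (cmod (u z) ^ 4) \<partial>lborel)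
      = (\<integral>\<^sup>+c. E c * ennreal (2 * pi * (cmod (g c 0))\<^sup>2) \<partial>lborel)"
    unfolding u4 by (subst nn_integral_cmult[symmetric]) (auto simp: g_def ennreal_mult mult_ac)
  also have "\<dots> \<le> (\<integral>\<^sup>+c. E c * I c \<partial>lborel)"
    unfolding I_def by (intro nn_integral_mono mult_left_mono gaussian_entire_ineq(1)[OF g_holo]) simp
  finally show "ennreal (2 * pi) * (\<integral>\<^sup>+z. ennreal (cmod (u z) ^ 4) \<partial>lborel)
      \<le> (\<integral>\<^sup>+w. \<integral>\<^sup>+z. ennreal ((cmod (u z))\<^sup>2 * (cmod (u w))\<^sup>2) \<partial>lborel \<partial>lborel)"
    unfolding mass .
  have "6 * (\<integral>\<^sup>+c. E c * I c \<partial>lborel) = (\<integral>\<^sup>+c. E c * (6 * I c) \<partial>lborel)"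
    by (subst nn_integral_cmult[symmetric]) (auto simp: mult_ac)
  also have "\<dots> \<le> (\<integral>\<^sup>+c. E c * (J c + ennreal (8 * pi * (cmod (g c 0))\<^sup>2)) \<partial>lborel)"
    unfolding I_def J_def
    by (intro nn_integral_mono mult_left_mono gaussian_entire_ineq(2)[OF g_holo g_deriv]) simp
  also have "\<dots> = (\<integral>\<^sup>+c. E c * J c + ennreal (8 * pi) * (E c * ennreal ((cmod (g c 0))\<^sup>2)) \<partial>lborel)"
    by (intro nn_integral_cong) (simp add: ennreal_mult' distrib_left mult_ac)
  also have "\<dots> = (\<integral>\<^sup>+c. E c * J c \<partial>lborel) + ennreal (8 * pi) * (\<integral>\<^sup>+c. E c * ennreal ((cmod (g c 0))\<^sup>2) \<partial>lborel)"
    by (subst nn_integral_add) (auto simp: g_def nn_integral_cmult)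
  finally show "6 * (\<integral>\<^sup>+w. \<integral>\<^sup>+z. ennreal ((cmod (u z))\<^sup>2 * (cmod (u w))\<^sup>2) \<partial>lborel \<partial>lborel)
      \<le> (\<integral>\<^sup>+w. \<integral>\<^sup>+z. ennreal ((cmod (z - w))\<^sup>2 * ((cmod (u z))\<^sup>2 * (cmod (u w))\<^sup>2)) \<partial>lborel \<partial>lborel)
        + ennreal (8 * pi) * (\<integral>\<^sup>+z. ennreal (cmod (u z) ^ 4) \<partial>lborel)"
    unfolding mass moment u4 .
qed

section \<open>Moments of \<open>u\<close> and passage from the two-point inequality to
  \<open>B\<close>\<close>

theorem theorem1p3:
  fixes u :: "complex \<Rightarrow> complex"
  assumes "u \<in> L21E"
  shows "B u \<ge> 0"
proof -
  obtain f where f: "f holomorphic_on UNIV"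
    and u: "\<And>z. u z = complex_of_real (exp (- (cmod z)\<^sup>2 / 2)) * f z"
    and weighted: "integrable lborel (\<lambda>z. (1 + (cmod z)\<^sup>2) * (cmod (u z))\<^sup>2)"
    using assms unfolding L21E_def by blast
  have [measurable]: "f \<in> borel_measurable borel"
    using f by (intro borel_measurable_continuous_onI holomorphic_on_imp_continuous_on)
  have [measurable]: "u \<in> borel_measurable borel"
    unfolding u[abs_def] by measurable
  define W where "W z = (cmod (u z))\<^sup>2" for z
  have [measurable]: "W \<in> borel_measurable borel"
    unfolding W_def[abs_def] by measurable
  have W_nonneg: "W z \<ge> 0" for z by (simp add: W_def)
  have int0: "integrable lborel W"
    by (rule Bochner_Integration.integrable_bound[OF weighted]) (auto simp: W_def distrib_right)
  have int2: "integrable lborel (\<lambda>z. (cmod z)\<^sup>2 * W z)"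
    by (rule Bochner_Integration.integrable_bound[OF weighted]) (auto simp: W_def distrib_right)
  have int1: "integrable lborel (\<lambda>z. z * complex_of_real (W z))"
  proof (rule Bochner_Integration.integrable_bound[OF weighted])
    \<comment> \<open>This lets the given weight dominate the first moment.\<close>
    have "cmod z \<le> 1 + (cmod z)\<^sup>2" for z
      using zero_le_power2[of "cmod z - 1"] zero_le_power2[of "cmod z"]
      by (simp only: power2_diff power_one mult_1_right)
    then show "AE z in lborel. norm (z * complex_of_real (W z)) \<le> norm ((1 + (cmod z)\<^sup>2) * (cmod (u z))\<^sup>2)"
      by (intro AE_I2) (simp add: norm_mult norm_power W_def mult_right_mono)
  qed simp
  define M where "M = mass u"
  define K where "K = (\<integral>z. (cmod z)\<^sup>2 * W z \<partial>lborel)"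
  define Q where "Q = magnetic_momentum u"
  define H where "H = (\<integral>z. (cmod (u z)) ^ 4 \<partial>lborel)"
  have M: "M = (\<integral>z. W z \<partial>lborel)"
    by (simp add: M_def mass_def W_def)
  have Q: "Q = (\<integral>z. z * complex_of_real (W z) \<partial>lborel)"
    by (simp add: Q_def magnetic_momentum_def W_def)
  have P: "angular_momentum u = K - M"
    using Bochner_Integration.integral_diff[OF int2 int0]
    by (simp add: angular_momentum_def K_def M W_def[abs_def] left_diff_distrib)
  have M_nonneg: "M \<ge> 0" unfolding M by (simp add: W_nonneg)
  have double_mass: "(\<integral>\<^sup>+w. \<integral>\<^sup>+z. ennreal (W z * W w) \<partial>lborel \<partial>lborel) = ennreal (M\<^sup>2)"
    by (simp add: ennreal_mult W_nonneg nn_integral_cmult nn_integral_multc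
        nn_integral_eq_integral[OF int0] M_nonneg M[symmetric] power2_eq_square)
  \<comment> \<open>The cross term of \<open>(cmod (z - w))\<^sup>2\<close>, kept for general
    \<open>c\<close>: the inner integration uses \<open>c = cnj w\<close>, the outer one
    \<open>c = cnj Q\<close>.\<close>
  have linear: "integrable lborel (\<lambda>z. 2 * Re (c * (z * complex_of_real (W z))))"
      "(\<integral>z. 2 * Re (c * (z * complex_of_real (W z))) \<partial>lborel) = 2 * Re (c * Q)" for c
  proof -
    have "has_bochner_integral lborel (\<lambda>z. z * complex_of_real (W z)) Q"
      unfolding Q using int1 by (rule has_bochner_integral_integrable)
    then have "has_bochner_integral lborel (\<lambda>z. 2 * Re (c * (z * complex_of_real (W z)))) (2 * Re (c * Q))"
      by (intro has_bochner_integral_mult_right has_bochner_integral_bounded_linear[OF bounded_linear_Re])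
    then show "integrable lborel (\<lambda>z. 2 * Re (c * (z * complex_of_real (W z))))"
      "(\<integral>z. 2 * Re (c * (z * complex_of_real (W z))) \<partial>lborel) = 2 * Re (c * Q)"
      by (simp_all only: has_bochner_integral_iff)
  qed
  have inner: "integrable lborel (\<lambda>z. (cmod (z - w))\<^sup>2 * W z)"
      "(\<integral>z. (cmod (z - w))\<^sup>2 * W z \<partial>lborel) = K - 2 * Re (cnj w * Q) + (cmod w)\<^sup>2 * M" for w
  proof -
    have eq: "(cmod (z - w))\<^sup>2 * W z = (cmod z)\<^sup>2 * W z - 2 * Re (cnj w * (z * complex_of_real (W z))) + (cmod w)\<^sup>2 * W z" for z
      unfolding cmod_power2 by (simp add: power2_eq_square algebra_simps)
    show "integrable lborel (\<lambda>z. (cmod (z - w))\<^sup>2 * W z)"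
      "(\<integral>z. (cmod (z - w))\<^sup>2 * W z \<partial>lborel) = K - 2 * Re (cnj w * Q) + (cmod w)\<^sup>2 * M"
      using linear[of "cnj w"] int0 int2 unfolding eq by (simp_all del: times_complex.sel add: K_def M)
  qed
  have outer: "integrable lborel (\<lambda>w. (K - 2 * Re (cnj w * Q) + (cmod w)\<^sup>2 * M) * W w)"
      "(\<integral>w. (K - 2 * Re (cnj w * Q) + (cmod w)\<^sup>2 * M) * W w \<partial>lborel) = 2 * M * K - 2 * (cmod Q)\<^sup>2"
  proof -
    have eq: "(K - 2 * Re (cnj w * Q) + (cmod w)\<^sup>2 * M) * W w
        = K * W w - 2 * Re (cnj Q * (w * complex_of_real (W w))) + M * ((cmod w)\<^sup>2 * W w)" for w
      by (simp add: algebra_simps)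
    have "2 * Re (cnj Q * Q) = 2 * (cmod Q)\<^sup>2"
      unfolding cmod_power2 by (simp add: power2_eq_square)
    then show "integrable lborel (\<lambda>w. (K - 2 * Re (cnj w * Q) + (cmod w)\<^sup>2 * M) * W w)"
      "(\<integral>w. (K - 2 * Re (cnj w * Q) + (cmod w)\<^sup>2 * M) * W w \<partial>lborel) = 2 * M * K - 2 * (cmod Q)\<^sup>2"
      using linear[of "cnj Q"] int0 int2 unfolding eq by (simp_all del: times_complex.sel add: K_def M)
  qed
  \<comment> \<open>Signs are read off from the integrals of nonnegative functions. They are needed
    because \<open>ennreal\<close> sends negative reals to 0.\<close>
  have inner_nonneg: "K - 2 * Re (cnj w * Q) + (cmod w)\<^sup>2 * M \<ge> 0" for w
    unfolding inner(2)[symmetric] by (simp add: W_nonneg)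
  have outer_nonneg: "2 * M * K - 2 * (cmod Q)\<^sup>2 \<ge> 0"
    unfolding outer(2)[symmetric] by (intro Bochner_Integration.integral_nonneg mult_nonneg_nonneg inner_nonneg W_nonneg)
  have double_moment: "(\<integral>\<^sup>+w. \<integral>\<^sup>+z. ennreal ((cmod (z - w))\<^sup>2 * (W z * W w)) \<partial>lborel \<partial>lborel)
      = ennreal (2 * M * K - 2 * (cmod Q)\<^sup>2)"
  proof -
    have "(\<integral>\<^sup>+z. ennreal ((cmod (z - w))\<^sup>2 * (W z * W w)) \<partial>lborel)
        = ennreal ((K - 2 * Re (cnj w * Q) + (cmod w)\<^sup>2 * M) * W w)" for w
    proof -
      have "(\<integral>\<^sup>+z. ennreal ((cmod (z - w))\<^sup>2 * (W z * W w)) \<partial>lborel)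
          = (\<integral>\<^sup>+z. ennreal ((cmod (z - w))\<^sup>2 * W z) * ennreal (W w) \<partial>lborel)"
        by (intro nn_integral_cong) (simp add: ennreal_mult[symmetric] W_nonneg mult_ac)
      also have "\<dots> = (\<integral>\<^sup>+z. ennreal ((cmod (z - w))\<^sup>2 * W z) \<partial>lborel) * ennreal (W w)"
        by (rule nn_integral_multc) measurable
      also have "\<dots> = ennreal ((K - 2 * Re (cnj w * Q) + (cmod w)\<^sup>2 * M) * W w)"
        by (subst nn_integral_eq_integral[OF inner(1)])
          (simp_all only: inner(2) ennreal_mult[OF inner_nonneg W_nonneg], simp add: W_nonneg)
      finally show ?thesis .
    qed
    then show ?thesis
      using nn_integral_eq_integral[OF outer(1)] inner_nonneg W_nonneg outer(2) by simp
  qed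
  note ineqs = two_point_ineq[OF f u, folded W_def, unfolded double_mass double_moment]
  \<comment> \<open>The first two-point bound gives at most \<open>M\<^sup>2 / (2 * pi)\<close>.
    Hence the Bochner integral \<open>H\<close> is the true value and not the default 0.\<close>
  have "(\<integral>\<^sup>+z. ennreal (cmod (u z) ^ 4) \<partial>lborel) < \<infinity>"
  proof (rule ccontr)
    assume "\<not> ?thesis"
    then have "(\<integral>\<^sup>+z. ennreal (cmod (u z) ^ 4) \<partial>lborel) = \<infinity>"
      by (simp add: less_top[symmetric])
    then show False
      using ineqs(1) by (simp add: ennreal_mult_eq_top_iff top_unique)
  qed
  then have "integrable lborel (\<lambda>z. cmod (u z) ^ 4)"
    by (intro integrableI_nonneg) auto
  then have H: "(\<integral>\<^sup>+z. ennreal (cmod (u z) ^ 4) \<partial>lborel) = ennreal H"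
    unfolding H_def by (intro nn_integral_eq_integral) auto
  have H_nonneg: "H \<ge> 0" by (simp add: H_def)
  have "ennreal (6 * M\<^sup>2) \<le> ennreal ((2 * M * K - 2 * (cmod Q)\<^sup>2) + 8 * pi * H)"
    using ineqs(2) H_nonneg outer_nonneg by (simp add: H ennreal_mult)
  then have "6 * M\<^sup>2 \<le> (2 * M * K - 2 * (cmod Q)\<^sup>2) + 8 * pi * H"
    using H_nonneg outer_nonneg by (subst (asm) ennreal_le_iff) auto
  \<comment> \<open>Here \<open>H\<close> lacks the factor 1/4 of the Hamiltonian. The coefficient 6
    is 4 from the last term of \<open>B\<close> plus 2 from replacing the angular momentum by
    \<open>K - M\<close>.\<close>
  moreover have "8 * B u = 8 * pi * H + (2 * M * K - 2 * (cmod Q)\<^sup>2) - 6 * M\<^sup>2"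
    by (simp add: B_def hamiltonian_def P H_def[symmetric] M_def[symmetric] Q_def[symmetric]
        algebra_simps power2_eq_square)
  ultimately show ?thesis by linarith
qed

end
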